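(* Let $G$ be a countable discrete infinite amenable group and let $(X,G)$ be a $G$-system with u.p.e. Then $(X,G)$ is mildly mixing.
   Context: Let $F(G)$ be the set of non-empty finite subsets of $G$. A sequence $\{F_n\}_{n\in\mathbb{N}}\subseteq F(G)$ is a Følner sequence if for all $K\in F(G)$ and $\delta>0$ one has $|K^{-1}F_n\cap K^{-1}(G\setminus F_n)|<\delta|F_n|$ for all large $n$. A $G$-system $(X,G)$ is a compact metric space $X$ with a continuous action $G\times X\to X$. For a finite cover $\mathcal{U}$ of $X$ and $F\in F(G)$, $\mathcal{U}_F=\bigvee_{g\in F}g^{-1}\mathcal{U}$ (the family of intersections); $N(\mathcal{U})$ is the minimal cardinality of a subfamily of $\mathcal{U}$ covering $X$; $h_{\text{top}}(G,\mathcal{U})=\lim_{n\to+\infty}\frac{1}{|F_n|}\log N(\mathcal{U}_{F_n})$, the limit existing and being independent of the Følner sequence. $(X,G)$ has u.p.e. if every cover $\mathcal{U}$ of $X$ by two non-dense open sets has $h_{\text{top}}(G,\mathcal{U})>0$. $(X,G)$ is transitive if for all non-empty open $U,V\subseteq X$ the set $N(U,V)=\{g\in G:U\cap g^{-1}V\ne\emptyset\}$ is non-empty. $(X,G)$ is mildly mixing if the product $G$-system $(X\times Y,G)$ (diagonal action) is transitive for each transitive $G$-system $(Y,G)$ containing no isolated points. *)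

theory Defs
  imports "HOL-Analysis.Analysis" "HOL-Algebra.Group_Action"
begin

definition fin_subsets :: "('g, 'm) monoid_scheme \<Rightarrow> 'g set set" where
  "fin_subsets G = {F. F \<subseteq> carrier G \<and> finite F \<and> F \<noteq> {}}"

definition folner_seq :: "('g, 'm) monoid_scheme \<Rightarrow> (nat \<Rightarrow> 'g set) \<Rightarrow> bool" where
  "folner_seq G F \<longleftrightarrow>
     range F \<subseteq> fin_subsets G \<and>
     (\<forall>K \<in> fin_subsets G. \<forall>\<delta>::real. \<delta> > 0 \<longrightarrow>
        (\<forall>\<^sub>F n in sequentially.
           real (card ((set_inv\<^bsub>G\<^esub> K <#>\<^bsub>G\<^esub> F n) \<inter>
                       (set_inv\<^bsub>G\<^esub> K <#>\<^bsub>G\<^esub> (carrier G - F n))))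
             < \<delta> * real (card (F n))))"

text \<open>For countable discrete groups, amenability is the existence of a Folner sequence.\<close>

definition amenable :: "('g, 'm) monoid_scheme \<Rightarrow> bool" where
  "amenable G \<longleftrightarrow> (\<exists>F. folner_seq G F)"

definition G_system :: "('g, 'm) monoid_scheme \<Rightarrow> 'x metric \<Rightarrow> ('g \<Rightarrow> 'x \<Rightarrow> 'x) \<Rightarrow> bool" where
  "G_system G X \<phi> \<longleftrightarrow>
     compact_space (mtopology_of X) \<and>
     group_action G (mspace X) \<phi> \<and>
     continuous_map (prod_topology (discrete_topology (carrier G)) (mtopology_of X))
       (mtopology_of X) (\<lambda>(g, x). \<phi> g x)"

text \<open>The diagonal action on the product. It is restricted to the product of the two spaces because
  the maps of a \<^const>\<open>group_action\<close> are required to be extensional.\<close>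

definition diag_action ::
  "'x metric \<Rightarrow> ('g \<Rightarrow> 'x \<Rightarrow> 'x) \<Rightarrow> 'y metric \<Rightarrow> ('g \<Rightarrow> 'y \<Rightarrow> 'y) \<Rightarrow> 'g \<Rightarrow> 'x \<times> 'y \<Rightarrow> 'x \<times> 'y" where
  "diag_action X \<phi> Y \<psi> g = (\<lambda>p \<in> mspace X \<times> mspace Y. (\<phi> g (fst p), \<psi> g (snd p)))"

definition pull_back :: "'x set \<Rightarrow> ('g \<Rightarrow> 'x \<Rightarrow> 'x) \<Rightarrow> 'g \<Rightarrow> 'x set \<Rightarrow> 'x set" where
  "pull_back S \<phi> g A = {x \<in> S. \<phi> g x \<in> A}"

text \<open>The join over \<open>g \<in> F\<close> of the covers \<open>g\<^sup>-\<^sup>1 \<U>\<close>: an element of it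
  arises by choosing one member \<open>A g\<close> of \<open>\<U>\<close> for every \<open>g \<in> F\<close>.\<close>

definition join_cover ::
  "'x set \<Rightarrow> ('g \<Rightarrow> 'x \<Rightarrow> 'x) \<Rightarrow> 'x set set \<Rightarrow> 'g set \<Rightarrow> 'x set set" where
  "join_cover S \<phi> \<U> F = {\<Inter>g\<in>F. pull_back S \<phi> g (A g) | A. A \<in> F \<rightarrow> \<U>}"

definition cover_number :: "'x set \<Rightarrow> 'x set set \<Rightarrow> nat" where
  "cover_number S \<U> =
     (LEAST n. \<exists>\<V>. \<V> \<subseteq> \<U> \<and> finite \<V> \<and> S \<subseteq> \<Union>\<V> \<and> card \<V> = n)"

text \<open>The common limit along all Folner sequences, which exists by the Ornstein--Weiss lemma and
  is unique as soon as there is a Folner sequence.\<close>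

definition h_top ::
  "('g, 'm) monoid_scheme \<Rightarrow> 'x metric \<Rightarrow> ('g \<Rightarrow> 'x \<Rightarrow> 'x) \<Rightarrow> 'x set set \<Rightarrow> real" where
  "h_top G X \<phi> \<U> =
     (THE h. \<forall>F. folner_seq G F \<longrightarrow>
        (\<lambda>n. ln (real (cover_number (mspace X) (join_cover (mspace X) \<phi> \<U> (F n))))
               / real (card (F n))) \<longlonglongrightarrow> h)"

definition upe :: "('g, 'm) monoid_scheme \<Rightarrow> 'x metric \<Rightarrow> ('g \<Rightarrow> 'x \<Rightarrow> 'x) \<Rightarrow> bool" where
  "upe G X \<phi> \<longleftrightarrow>
     (\<forall>U V. openin (mtopology_of X) U \<and> openin (mtopology_of X) V \<and>
            mtopology_of X closure_of U \<noteq> mspace X \<and>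
            mtopology_of X closure_of V \<noteq> mspace X \<and>
            U \<union> V = mspace X
        \<longrightarrow> h_top G X \<phi> {U, V} > 0)"

definition return_set ::
  "('g, 'm) monoid_scheme \<Rightarrow> 'x metric \<Rightarrow> ('g \<Rightarrow> 'x \<Rightarrow> 'x) \<Rightarrow> 'x set \<Rightarrow> 'x set \<Rightarrow> 'g set" where
  "return_set G X \<phi> U V = {g \<in> carrier G. U \<inter> pull_back (mspace X) \<phi> g V \<noteq> {}}"

definition transitive_system ::
  "('g, 'm) monoid_scheme \<Rightarrow> 'x metric \<Rightarrow> ('g \<Rightarrow> 'x \<Rightarrow> 'x) \<Rightarrow> bool" where
  "transitive_system G X \<phi> \<longleftrightarrow>
     (\<forall>U V. openin (mtopology_of X) U \<and> U \<noteq> {} \<and> openin (mtopology_of X) V \<and> V \<noteq> {}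
        \<longrightarrow> return_set G X \<phi> U V \<noteq> {})"

definition no_isolated_points :: "'x metric \<Rightarrow> bool" where
  "no_isolated_points X \<longleftrightarrow> (\<forall>x \<in> mspace X. \<not> openin (mtopology_of X) {x})"

text \<open>HOL cannot quantify over types inside a formula, so the type \<open>'y\<close> from which the
  points of the test systems \<open>Y\<close> are drawn is a parameter. Theorems about mild mixing should
  leave \<open>'y\<close> arbitrary. (A compact metric space has at most continuum many points, so that
  \<open>'y = real\<close> already covers all test systems up to isometry.)\<close>

definition mildly_mixing ::
  "'y itself \<Rightarrow> ('g, 'm) monoid_scheme \<Rightarrow> 'x metric \<Rightarrow> ('g \<Rightarrow> 'x \<Rightarrow> 'x) \<Rightarrow> bool" where
  "mildly_mixing _ G X \<phi> \<longleftrightarrow>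
     (\<forall>(Y :: 'y metric) \<psi>.
        G_system G Y \<psi> \<and> transitive_system G Y \<psi> \<and> no_isolated_points Y
        \<longrightarrow> transitive_system G (prod_metric X Y) (diag_action X \<phi> Y \<psi>))"

lemma h_top_eqI:
  assumes "amenable G"
    and lim: "\<And>F. folner_seq G F \<Longrightarrow>
      (\<lambda>n. ln (real (cover_number (mspace X) (join_cover (mspace X) \<phi> \<U> (F n))))
             / real (card (F n))) \<longlonglongrightarrow> h"
  shows "h_top G X \<phi> \<U> = h"
proof -
  obtain F where F: "folner_seq G F"
    using assms(1) by (auto simp: amenable_def)
  show ?thesis
    unfolding h_top_def
  proof (rule the_equality)
    fix k
    assume "\<forall>F. folner_seq G F \<longrightarrow>
      (\<lambda>n. ln (real (cover_number (mspace X) (join_cover (mspace X) \<phi> \<U> (F n))))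
             / real (card (F n))) \<longlonglongrightarrow> k"
    then show "k = h"
      using F lim[OF F] LIMSEQ_unique by blast
  qed (use lim in blast)
qed

lemma G_system_diag_action:
  assumes X: "G_system G X \<phi>" and Y: "G_system G Y \<psi>"
  shows "G_system G (prod_metric X Y) (diag_action X \<phi> Y \<psi>)"
proof -
  interpret X: group_action G "mspace X" \<phi> using X by (simp add: G_system_def)
  interpret Y: group_action G "mspace Y" \<psi> using Y by (simp add: G_system_def)
  have grp: "group G" using X.group_hom group_hom.axioms(1) by blast
  let ?d = "diag_action X \<phi> Y \<psi>" and ?S = "mspace X \<times> mspace Y"
  have bij: "bij_betw (?d g) ?S ?S" if g: "g \<in> carrier G" for g
  proof -
    have "bij_betw (map_prod (\<phi> g) (\<psi> g)) ?S ?S"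
      using X.inj_prop[OF g] X.surj_prop[OF g] Y.inj_prop[OF g] Y.surj_prop[OF g]
      by (intro bij_betw_map_prod) (auto simp: bij_betw_def)
    then show ?thesis
      by (rule bij_betw_cong[THEN iffD1, rotated]) (auto simp: diag_action_def)
  qed
  have Bij: "?d g \<in> Bij ?S" if "g \<in> carrier G" for g
    using bij[OF that] by (auto simp: Bij_def diag_action_def)
  have "?d \<in> hom G (BijGroup ?S)"
  proof (rule homI)
    fix g h assume gh: "g \<in> carrier G" "h \<in> carrier G"
    have "?d (g \<otimes>\<^bsub>G\<^esub> h) p = compose ?S (?d g) (?d h) p" for p
    proof (cases "p \<in> ?S")
      case True
      then obtain x y where p: "p = (x, y)" "x \<in> mspace X" "y \<in> mspace Y" by auto
      have "\<phi> h x \<in> mspace X" "\<psi> h y \<in> mspace Y"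
        using X.element_image[OF gh(2) p(2) refl] Y.element_image[OF gh(2) p(3) refl] .
      then show ?thesis
        using p X.composition_rule[OF p(2) gh] Y.composition_rule[OF p(3) gh]
        by (simp add: compose_def diag_action_def)
    qed (simp add: compose_def diag_action_def)
    then show "?d (g \<otimes>\<^bsub>G\<^esub> h) = ?d g \<otimes>\<^bsub>BijGroup ?S\<^esub> ?d h"
      using Bij[OF gh(1)] Bij[OF gh(2)] by (simp add: BijGroup_def fun_eq_iff)
  qed (use Bij in \<open>simp add: BijGroup_def\<close>)
  then have act: "group_action G ?S ?d"
    by (simp add: group_action_def group_hom_def group_hom_axioms_def grp group_BijGroup)
  let ?D = "discrete_topology (carrier G)" and ?TX = "mtopology_of X" and ?TY = "mtopology_of Y"
  let ?P = "prod_topology ?D (prod_topology ?TX ?TY)"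
  have cX: "continuous_map ?P ?TX (\<lambda>p. \<phi> (fst p) (fst (snd p)))"
  proof -
    have "continuous_map ?P (prod_topology ?D ?TX) (\<lambda>p. (fst p, fst (snd p)))"
      by (intro continuous_map_pairedI continuous_intros continuous_map_fst
          continuous_map_compose[OF continuous_map_snd continuous_map_fst, unfolded o_def])
    from continuous_map_compose[OF this, of ?TX "\<lambda>(g, x). \<phi> g x"] show ?thesis
      using X by (simp add: G_system_def o_def)
  qed
  have cY: "continuous_map ?P ?TY (\<lambda>p. \<psi> (fst p) (snd (snd p)))"
  proof -
    have "continuous_map ?P (prod_topology ?D ?TY) (\<lambda>p. (fst p, snd (snd p)))"
      by (intro continuous_map_pairedI continuous_intros continuous_map_fst
          continuous_map_compose[OF continuous_map_snd continuous_map_snd, unfolded o_def])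
    from continuous_map_compose[OF this, of ?TY "\<lambda>(g, x). \<psi> g x"] show ?thesis
      using Y by (simp add: G_system_def o_def)
  qed
  have "continuous_map ?P (prod_topology ?TX ?TY) (\<lambda>(g, x). ?d g x)"
    by (rule continuous_map_eq[OF continuous_map_pairedI[OF cX cY]])
       (auto simp: diag_action_def)
  then show ?thesis
    using X Y act by (simp add: G_system_def compact_space_prod_topology)
qed

end

theory Submission
  imports Defs
begin

text \<open>Suppose that \<open>X\<close> has u.p.e. and that \<open>Y\<close> is transitive without isolated points, but that
  \<open>N(U1, U2)\<close> and \<open>N(V1, V2)\<close> are disjoint for some non-empty open sets, so that \<open>X \<times> Y\<close> is not
  transitive. Choose \<open>h\<close> with \<open>V = V1 \<inter> h\<^sup>-\<^sup>1 V2 \<noteq> \<emptyset>\<close>. If \<open>g \<in> N(V, V)\<close>, then \<open>hg \<in> N(V1, V2)\<close>, and hence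
  \<open>g \<notin> N(U1, h\<^sup>-\<^sup>1 U2)\<close>. The sets \<open>U1\<close> and \<open>h\<^sup>-\<^sup>1 U2\<close> are disjoint because \<open>h \<in> N(V1, V2)\<close>; choose
  closed sets \<open>A\<close> and \<open>B\<close> with non-empty interior inside them. The complements of \<open>A\<close> and \<open>B\<close> form a
  cover by two non-dense open sets, so by u.p.e. its entropy is positive. The proof shows that
  the entropy is zero.

  Since \<open>Y\<close> is transitive without isolated points, return sets in \<open>Y\<close> are never contained in a
  finite set, and so there are arbitrarily large finite sets \<open>K\<close> of group elements that all send a
  single point \<open>y\<close> into \<open>V\<close> (\<open>many_simultaneous_visits\<close>). For \<open>g, k \<in> K\<close> the element \<open>k g\<^sup>-\<^sup>1\<close> lies
  in \<open>N(V, V)\<close>, so no \<open>x \<in> X\<close> can satisfy \<open>gx \<in> A\<close> and \<open>kx \<in> B\<close>: the orbit segment \<open>Kx\<close> misses \<open>A\<close>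
  or misses \<open>B\<close> (\<open>constant_itinerary_on_complements\<close>). The same holds for every right translate
  \<open>Kc\<close>. Thus joining the cover over a whole translate \<open>Kc\<close> multiplies the number of sets needed by
  at most two, as joining it over a single group element would.

  It remains to cover a set \<open>F\<close> far along a Folner sequence by few translates of \<open>K\<close>. Here
  \<open>|K\<^sup>-\<^sup>1 F| \<le> 2 |F|\<close> by the Folner property, and by double counting some translate contains a proportion of at least
  \<open>|K| / (2 |F|)\<close> of any given subset of \<open>F\<close>. A greedy selection, stopped when fewer than \<open>\<epsilon> |F|\<close>
  elements are left and followed by singletons, uses at most \<open>(2 / (\<epsilon> |K|) + \<epsilon>) |F|\<close> pieces.
  As \<open>|K|\<close> may be taken arbitrarily large, this is \<open>o(|F|)\<close>, and the entropy along every Folner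
  sequence is zero.\<close>

section \<open>Subcovers of joins\<close>

text \<open>For a given point one member of \<open>\<U>\<close> serves for all times in \<open>B\<close>; it may vary with the
  point.\<close>

definition constant_itinerary_on ::
  "'x set \<Rightarrow> ('g \<Rightarrow> 'x \<Rightarrow> 'x) \<Rightarrow> 'x set set \<Rightarrow> 'g set \<Rightarrow> bool" where
  "constant_itinerary_on S \<phi> \<U> B \<longleftrightarrow> (\<forall>x\<in>S. \<exists>U\<in>\<U>. \<forall>g\<in>B. \<phi> g x \<in> U)"

definition join_subcover ::
  "'x set \<Rightarrow> ('g \<Rightarrow> 'x \<Rightarrow> 'x) \<Rightarrow> 'x set set \<Rightarrow> 'g set \<Rightarrow> nat \<Rightarrow> bool" where
  "join_subcover S \<phi> \<U> F k \<longleftrightarrow>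
     (\<exists>\<V>. \<V> \<subseteq> join_cover S \<phi> \<U> F \<and> finite \<V> \<and> S \<subseteq> \<Union>\<V> \<and> card \<V> \<le> k)"

lemma constant_itinerary_on_subset: "constant_itinerary_on S \<phi> \<U> B \<Longrightarrow> C \<subseteq> B \<Longrightarrow> constant_itinerary_on S \<phi> \<U> C"
  unfolding constant_itinerary_on_def by (meson subsetD)

lemma cover_number_le:
  assumes "join_subcover S \<phi> \<U> F k"
  shows "cover_number S (join_cover S \<phi> \<U> F) \<le> k"
proof -
  obtain \<V> where "\<V> \<subseteq> join_cover S \<phi> \<U> F" "finite \<V>" "S \<subseteq> \<Union>\<V>" "card \<V> \<le> k"
    using assms unfolding join_subcover_def by blast
  then have "cover_number S (join_cover S \<phi> \<U> F) \<le> card \<V>"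
    unfolding cover_number_def by (intro Least_le exI[of _ \<V>]) simp
  then show ?thesis
    using \<open>card \<V> \<le> k\<close> by (rule order_trans)
qed

lemma join_subcover_empty: "join_subcover S \<phi> \<U> {} 1"
proof -
  have "join_cover S \<phi> \<U> {} = {UNIV}"
    unfolding join_cover_def by auto
  then show ?thesis
    unfolding join_subcover_def by (intro exI[of _ "{UNIV}"]) simp
qed

text \<open>On \<open>B\<close> only the members of the join that choose the same \<open>U \<in> \<U>\<close> at all times are needed,
  so the whole block \<open>B\<close> contributes a single factor \<open>card \<U>\<close>.\<close>

lemma join_subcover_Un:
  assumes "join_subcover S \<phi> \<U> E k" and B: "constant_itinerary_on S \<phi> \<U> B" and "finite \<U>" and "E \<inter> B = {}"
  shows "join_subcover S \<phi> \<U> (E \<union> B) (k * card \<U>)"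
proof -
  obtain \<V> where \<V>: "\<V> \<subseteq> join_cover S \<phi> \<U> E" "finite \<V>" "S \<subseteq> \<Union>\<V>" "card \<V> \<le> k"
    using assms(1) unfolding join_subcover_def by blast
  define c where "c = (\<lambda>(V, U). V \<inter> (\<Inter>g\<in>B. pull_back S \<phi> g U))"
  have "c ` (\<V> \<times> \<U>) \<subseteq> join_cover S \<phi> \<U> (E \<union> B)"
  proof clarify
    fix V U assume "V \<in> \<V>" and U: "U \<in> \<U>"
    then obtain A where A: "A \<in> E \<rightarrow> \<U>" "V = (\<Inter>g\<in>E. pull_back S \<phi> g (A g))"
      using \<V>(1) unfolding join_cover_def by blast
    let ?A = "\<lambda>g. if g \<in> B then U else A g"
    have "(\<Inter>g\<in>E. pull_back S \<phi> g (?A g)) = V"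
      unfolding A(2) using \<open>E \<inter> B = {}\<close> by (intro INF_cong) auto
    then have "c (V, U) = (\<Inter>g\<in>E \<union> B. pull_back S \<phi> g (?A g))"
      by (simp add: c_def INF_union)
    moreover have "?A \<in> E \<union> B \<rightarrow> \<U>"
      using A(1) U by auto
    ultimately show "c (V, U) \<in> join_cover S \<phi> \<U> (E \<union> B)"
      unfolding join_cover_def by (intro CollectI exI[of _ ?A] conjI)
  qed
  moreover have "S \<subseteq> \<Union>(c ` (\<V> \<times> \<U>))"
  proof
    fix x assume x: "x \<in> S"
    then obtain V U where "V \<in> \<V>" "x \<in> V" "U \<in> \<U>" "\<forall>g\<in>B. \<phi> g x \<in> U"
      using \<V>(3) B unfolding constant_itinerary_on_def by blast
    then show "x \<in> \<Union>(c ` (\<V> \<times> \<U>))"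
      using x by (intro UnionI[of "c (V, U)"]) (auto simp: c_def pull_back_def)
  qed
  moreover have "card (c ` (\<V> \<times> \<U>)) \<le> k * card \<U>"
    using card_image_le[of "\<V> \<times> \<U>" c] \<V>(2) \<open>finite \<U>\<close> mult_le_mono1[OF \<V>(4), of "card \<U>"]
    by (simp add: card_cartesian_product order_trans)
  ultimately show ?thesis
    unfolding join_subcover_def using \<V>(2) \<open>finite \<U>\<close> by blast
qed

lemma join_subcover_singletons:
  assumes "finite E" "finite \<U>" and "\<And>g. g \<in> E \<Longrightarrow> constant_itinerary_on S \<phi> \<U> {g}"
  shows "join_subcover S \<phi> \<U> E (card \<U> ^ card E)"
  using assms(1,3)
proof (induction E)
  case (insert g E)
  then show ?case
    using join_subcover_Un[of S \<phi> \<U> E "card \<U> ^ card E" "{g}"] \<open>finite \<U>\<close>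
    by (simp add: mult.commute)
qed (use join_subcover_empty in simp)

text \<open>Remove blocks of at least \<open>t\<close> elements with constant itinerary as long as at least \<open>d\<close>
  elements remain. There are at most \<open>card E / t\<close> such steps, and fewer than \<open>d\<close> elements are left
  to be treated as singletons.\<close>

lemma join_subcover_greedy:
  fixes t d :: real
  assumes "finite F" "finite \<U>" and "t > 0"
    and single: "\<And>g. g \<in> F \<Longrightarrow> constant_itinerary_on S \<phi> \<U> {g}"
    and large: "\<And>E. E \<subseteq> F \<Longrightarrow> d \<le> card E \<Longrightarrow> E \<noteq> {} \<Longrightarrow> \<exists>B\<subseteq>E. constant_itinerary_on S \<phi> \<U> B \<and> t \<le> card B"
    and "d > 0"
  shows "E \<subseteq> F \<Longrightarrow> \<exists>l. join_subcover S \<phi> \<U> E (card \<U> ^ l) \<and> l \<le> card E / t + d"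
proof (induction "card E" arbitrary: E rule: less_induct)
  case less
  have fE: "finite E"
    using less.prems \<open>finite F\<close> finite_subset by blast
  show ?case
  proof (cases "d \<le> card E")
    case False
    then have "real (card E) \<le> card E / t + d"
      using \<open>t > 0\<close> by (simp add: add_increasing)
    then show ?thesis
      using join_subcover_singletons[OF fE \<open>finite \<U>\<close>, of S \<phi>] single less.prems by blast
  next
    case True
    then have "E \<noteq> {}"
      using \<open>d > 0\<close> by auto
    then obtain B where B: "B \<subseteq> E" "constant_itinerary_on S \<phi> \<U> B" "t \<le> card B"
      using large[OF less.prems True] by blast
    have card: "card (E - B) = card E - card B" "card B \<le> card E"
      using B(1) fE by (simp_all add: card_Diff_subset finite_subset card_mono)
    have "card B > 0"
      using B(3) \<open>t > 0\<close> by linarith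
    then have "card (E - B) < card E"
      using card by linarith
    then obtain l where l: "join_subcover S \<phi> \<U> (E - B) (card \<U> ^ l)" "l \<le> card (E - B) / t + d"
      using less.hyps[of "E - B"] less.prems by blast
    have "join_subcover S \<phi> \<U> E (card \<U> ^ Suc l)"
      using join_subcover_Un[OF l(1) B(2) \<open>finite \<U>\<close>] B(1)
      by (simp add: Un_absorb2 mult.commute Diff_Int_distrib2)
    moreover have "real (card (E - B)) / t + 1 \<le> card E / t"
      using B(3) \<open>t > 0\<close> card by (simp add: field_simps of_nat_diff)
    then have "real (Suc l) \<le> card E / t + d"
      using l(2) by simp
    ultimately show ?thesis
      by blast
  qed
qed

section \<open>Covering Folner sets by translates\<close>

text \<open>An element \<open>c\<close> of \<open>K\<^sup>-\<^sup>1 F\<close> outside the boundary satisfies \<open>Kc \<subseteq> F\<close>. For a fixed \<open>k \<in> K\<close>, left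
  multiplication by \<open>k\<close> therefore embeds the set of these \<open>c\<close> into \<open>F\<close>.\<close>

lemma (in group) card_boundary_bound:
  assumes K: "K \<subseteq> carrier G" "K \<noteq> {}" "finite K" and F: "F \<subseteq> carrier G" "finite F"
  shows "card (set_inv K <#> F) \<le> card F + card ((set_inv K <#> F) \<inter> (set_inv K <#> (carrier G - F)))"
proof -
  let ?D = "set_inv K <#> F" and ?C = "set_inv K <#> (carrier G - F)"
  have D: "?D = (\<lambda>(k, f). inv k \<otimes> f) ` (K \<times> F)"
    by (auto simp: set_mult_def SET_INV_def)
  have fin: "finite ?D"
    unfolding D using K F by simp
  have sub: "?D \<subseteq> carrier G"
    unfolding D using K F by auto
  obtain k where k: "k \<in> K"
    using K by blast
  have kG: "k \<in> carrier G"
    using k K by blast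
  have "k \<otimes> c \<in> F" if c: "c \<in> ?D - ?C" for c
  proof (rule ccontr)
    have cG: "c \<in> carrier G" using c sub by blast
    assume "k \<otimes> c \<notin> F"
    then have "inv k \<otimes> (k \<otimes> c) \<in> ?C"
      using k kG cG by (auto simp: set_mult_def SET_INV_def)
    then show False
      using c kG cG by (simp add: m_assoc[symmetric])
  qed
  then have "card (?D - ?C) \<le> card F"
    using F inj_on_subset[OF inj_on_cmult[OF kG], of "?D - ?C"] sub
    by (intro card_inj_on_le[of "\<lambda>c. k \<otimes> c"]) auto
  moreover have "card ?D = card (?D - ?C) + card (?D \<inter> ?C)"
    using fin by (metis Int_Diff_Un Int_Diff_disjoint card_Un_disjoint finite_Diff finite_Int add.commute)
  ultimately show ?thesis
    by linarith
qed

text \<open>Each \<open>e \<in> E\<close> lies in \<open>Kc\<close> for exactly \<open>card K\<close> elements \<open>c\<close>, namely \<open>c = k\<^sup>-\<^sup>1 e\<close>, and all of them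
  lie in \<open>K\<^sup>-\<^sup>1 F\<close>. Hence \<open>card K * card E\<close> is the sum of \<open>card (Kc \<inter> E)\<close> over \<open>c \<in> K\<^sup>-\<^sup>1 F\<close>, and some
  term is at least the average.\<close>

lemma (in group) translate_meets_many:
  assumes K: "K \<subseteq> carrier G" "finite K" and F: "F \<subseteq> carrier G" "finite F" and E: "E \<subseteq> F" "E \<noteq> {}"
  shows "\<exists>c\<in>carrier G. card K * card E \<le> card (set_inv K <#> F) * card ((K #> c) \<inter> E)"
proof (cases "K = {}")
  case True
  then show ?thesis by auto
next
  case False
  let ?D = "set_inv K <#> F"
  have D: "?D = (\<lambda>(k, f). inv k \<otimes> f) ` (K \<times> F)"
    by (auto simp: set_mult_def SET_INV_def)
  have fin: "finite ?D"
    unfolding D using K F by simp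
  have sub: "?D \<subseteq> carrier G"
    unfolding D using K F by auto
  have fE: "finite E"
    using E F finite_subset by blast
  have ne: "?D \<noteq> {}"
    unfolding D using False E by auto
  have count: "card {c \<in> ?D. e \<in> K #> c} = card K" if e: "e \<in> E" for e
  proof -
    have eG: "e \<in> carrier G" "e \<in> F" using e E F by auto
    have "{c \<in> ?D. e \<in> K #> c} = (\<lambda>k. inv k \<otimes> e) ` K"
    proof (intro equalityI subsetI)
      fix c assume "c \<in> {c \<in> ?D. e \<in> K #> c}"
      then obtain k where k: "k \<in> K" "e = k \<otimes> c" "c \<in> carrier G"
        using sub by (auto simp: r_coset_def)
      then have "c = inv k \<otimes> e"
        using K by (metis inv_solve_left subsetD m_closed)
      then show "c \<in> (\<lambda>k. inv k \<otimes> e) ` K"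
        using k by blast
    next
      fix c assume "c \<in> (\<lambda>k. inv k \<otimes> e) ` K"
      then obtain k where k: "k \<in> K" "c = inv k \<otimes> e" by blast
      then have "k \<in> carrier G" using K by blast
      then have "e = k \<otimes> c"
        using k eG by (simp add: m_assoc[symmetric])
      then show "c \<in> {c \<in> ?D. e \<in> K #> c}"
        using k eG unfolding D by (auto simp: r_coset_def)
    qed
    moreover have "inj_on (\<lambda>k. inv k \<otimes> e) K"
      using K eG by (intro inj_onI) (metis inv_closed inv_inv right_cancel subsetD)
    ultimately show ?thesis
      by (simp add: card_image)
  qed
  have "(\<Sum>c\<in>?D. card ((K #> c) \<inter> E)) = (\<Sum>c\<in>?D. \<Sum>e\<in>E. if e \<in> K #> c then 1 else 0)"
    using fE by (intro sum.cong refl) (simp add: sum.If_cases Int_commute)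
  also have "\<dots> = (\<Sum>e\<in>E. \<Sum>c\<in>?D. if e \<in> K #> c then 1 else 0)"
    by (rule sum.swap)
  also have "\<dots> = (\<Sum>e\<in>E. card {c \<in> ?D. e \<in> K #> c})"
    using fin by (intro sum.cong refl) (simp add: sum.If_cases Int_def)
  also have "\<dots> = card K * card E"
    using count by (simp add: mult.commute)
  finally have sum: "(\<Sum>c\<in>?D. card ((K #> c) \<inter> E)) = card K * card E" .
  let ?M = "Max ((\<lambda>c. card ((K #> c) \<inter> E)) ` ?D)"
  have "card K * card E \<le> card ?D * ?M"
    unfolding sum[symmetric] using fin sum_bounded_above[of ?D "\<lambda>c. card ((K #> c) \<inter> E)" ?M] by simp
  moreover have "?M \<in> (\<lambda>c. card ((K #> c) \<inter> E)) ` ?D"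
    using fin ne by (intro Max_in) auto
  ultimately show ?thesis
    using sub by auto
qed

section \<open>Vanishing entropy\<close>

lemma constant_itinerary_on_translate:
  assumes act: "group_action G S \<phi>" and K: "K \<subseteq> carrier G" and c: "c \<in> carrier G"
    and un: "constant_itinerary_on S \<phi> \<U> K"
  shows "constant_itinerary_on S \<phi> \<U> (K #>\<^bsub>G\<^esub> c)"
  unfolding constant_itinerary_on_def
proof
  interpret group_action G S \<phi> by (fact act)
  fix x assume x: "x \<in> S"
  then have "\<phi> c x \<in> S"
    using element_image[OF c x] by blast
  then obtain U where U: "U \<in> \<U>" "\<forall>g\<in>K. \<phi> g (\<phi> c x) \<in> U"
    using un unfolding constant_itinerary_on_def by blast
  have "\<phi> g x \<in> U" if "g \<in> K #>\<^bsub>G\<^esub> c" for g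
  proof -
    obtain k where k: "k \<in> K" "g = k \<otimes>\<^bsub>G\<^esub> c"
      using \<open>g \<in> K #>\<^bsub>G\<^esub> c\<close> unfolding r_coset_def by blast
    then show ?thesis
      using composition_rule[OF x, of k c] U K c by auto
  qed
  then show "\<exists>U\<in>\<U>. \<forall>g\<in>K #>\<^bsub>G\<^esub> c. \<phi> g x \<in> U"
    using U by blast
qed

text \<open>A subset of \<open>F\<close> with at least \<open>\<epsilon> |F|\<close> elements meets some translate of \<open>K\<close> in at least
  \<open>t = \<epsilon> |K| / 2\<close> elements. The greedy selection with this \<open>t\<close> and \<open>d = \<epsilon> |F|\<close> gives \<open>|F| / t + d\<close>
  pieces, and \<open>2 \<le> \<epsilon>\<^sup>2 |K|\<close> says exactly that the first summand does not exceed the second.\<close>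

lemma folner_ln_cover_number_le:
  fixes G (structure) and \<epsilon> :: real
  assumes act: "group_action G S \<phi>" and "finite \<U>" and cover: "S \<subseteq> \<Union>\<U>"
    and K: "K \<in> fin_subsets G" "constant_itinerary_on S \<phi> \<U> K"
    and F: "F \<in> fin_subsets G" and \<epsilon>: "\<epsilon> > 0" "2 \<le> \<epsilon>\<^sup>2 * card K"
    and inv: "real (card ((set_inv\<^bsub>G\<^esub> K <#>\<^bsub>G\<^esub> F) \<inter> (set_inv\<^bsub>G\<^esub> K <#>\<^bsub>G\<^esub> (carrier G - F)))) < 1 * real (card F)"
  shows "ln (cover_number S (join_cover S \<phi> \<U> F)) \<le> 2 * \<epsilon> * card F * ln (card \<U>)"
proof (cases "S = {}")
  case True
  then have "cover_number S (join_cover S \<phi> \<U> F) = 0"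
    unfolding cover_number_def by (intro Least_eq_0 exI[of _ "{}"]) simp
  then show ?thesis
    using \<epsilon> by (cases "card \<U>") simp_all
next
  case False
  interpret group_action G S \<phi> by (fact act)
  interpret group G using group_hom group_hom.axioms(1) by blast
  have KG: "K \<subseteq> carrier G" "finite K" "K \<noteq> {}" and FG: "F \<subseteq> carrier G" "finite F" "F \<noteq> {}"
    using K F unfolding fin_subsets_def by auto
  let ?t = "\<epsilon> * card K / 2" and ?d = "\<epsilon> * card F"
  have pos: "real (card K) > 0" "real (card F) > 0"
    using KG FG by (auto simp: card_gt_0_iff)
  have D: "real (card (set_inv K <#> F)) \<le> 2 * card F"
    using card_boundary_bound[OF KG(1,3,2) FG(1,2)] inv by linarith
  have "\<exists>l. join_subcover S \<phi> \<U> F (card \<U> ^ l) \<and> l \<le> card F / ?t + ?d"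
  proof (rule join_subcover_greedy[OF FG(2) \<open>finite \<U>\<close>])
    show "?t > 0" "?d > 0"
      using \<epsilon> pos by simp_all
    show "constant_itinerary_on S \<phi> \<U> {g}" if "g \<in> F" for g
      using cover element_image[of g] that FG(1) unfolding constant_itinerary_on_def by blast
    fix E assume E: "E \<subseteq> F" "?d \<le> card E" "E \<noteq> {}"
    obtain c where c: "c \<in> carrier G"
      "card K * card E \<le> card (set_inv K <#> F) * card ((K #> c) \<inter> E)"
      using translate_meets_many[OF KG(1,2) FG(1,2) E(1,3)] by blast
    have "card K * ?d \<le> card K * real (card E)"
      using E(2) by (intro mult_left_mono) auto
    also have "\<dots> \<le> card (set_inv K <#> F) * real (card ((K #> c) \<inter> E))"
      using c(2) by (metis of_nat_le_iff of_nat_mult)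
    also have "\<dots> \<le> 2 * card F * real (card ((K #> c) \<inter> E))"
      using D by (intro mult_right_mono) auto
    finally have "?t \<le> card ((K #> c) \<inter> E)"
      using pos by (simp add: field_simps)
    moreover have "constant_itinerary_on S \<phi> \<U> ((K #> c) \<inter> E)"
      using constant_itinerary_on_translate[OF act KG(1) c(1) K(2)] constant_itinerary_on_subset by blast
    ultimately show "\<exists>B\<subseteq>E. constant_itinerary_on S \<phi> \<U> B \<and> ?t \<le> card B"
      by blast
  qed simp
  then obtain l where l: "join_subcover S \<phi> \<U> F (card \<U> ^ l)" "l \<le> card F / ?t + ?d"
    by blast
  have "card F / ?t \<le> ?d"
    using \<epsilon> pos by (simp add: field_simps power2_eq_square)
  then have l2: "real l \<le> 2 * \<epsilon> * card F"
    using l(2) by linarith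
  have "\<U> \<noteq> {}"
    using cover False by blast
  then have U: "card \<U> > 0"
    using \<open>finite \<U>\<close> by (simp add: card_gt_0_iff)
  let ?N = "cover_number S (join_cover S \<phi> \<U> F)"
  have "?N \<le> card \<U> ^ l"
    using cover_number_le[OF l(1)] .
  then have "ln (real ?N) \<le> ln (real (card \<U> ^ l))"
    using U by (cases "?N = 0") (simp_all add: ln_ge_zero)
  also have "\<dots> = l * ln (card \<U>)"
    using U by (simp add: ln_realpow)
  also have "\<dots> \<le> 2 * \<epsilon> * card F * ln (card \<U>)"
    using l2 U by (intro mult_right_mono) auto
  finally show ?thesis .
qed

text \<open>The limit is computed to be zero along every Folner sequence; this determines
  \<^const>\<open>h_top\<close> without an appeal to the existence of the limit for general covers.\<close>

lemma h_top_eq_0: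
  assumes am: "amenable G" and act: "group_action G (mspace X) \<phi>"
    and "finite \<U>" and cover: "mspace X \<subseteq> \<Union>\<U>"
    and arb: "\<And>m. \<exists>K\<in>fin_subsets G. m \<le> card K \<and> constant_itinerary_on (mspace X) \<phi> \<U> K"
  shows "h_top G X \<phi> \<U> = 0"
proof (rule h_top_eqI[OF am])
  fix F assume F: "folner_seq G F"
  let ?N = "\<lambda>n. cover_number (mspace X) (join_cover (mspace X) \<phi> \<U> (F n))"
  let ?q = "ln (real (card \<U>))"
  have Ffin: "F n \<in> fin_subsets G" for n
    using F unfolding folner_seq_def by blast
  have q: "?q \<ge> 0"
    by (cases "card \<U>") simp_all
  show "(\<lambda>n. ln (real (?N n)) / real (card (F n))) \<longlonglongrightarrow> 0"
  proof (rule LIMSEQ_I)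
    fix r :: real assume r: "r > 0"
    \<comment> \<open>The summand \<open>1\<close> allows for a cover with at most one member, for which \<open>?q = 0\<close>.\<close>
    define \<epsilon> where "\<epsilon> = r / (2 * (?q + 1))"
    have \<epsilon>: "\<epsilon> > 0" "2 * \<epsilon> * ?q < r"
      using r q by (simp_all add: \<epsilon>_def field_simps)
    obtain K where K: "K \<in> fin_subsets G" "nat \<lceil>2 / \<epsilon>\<^sup>2\<rceil> \<le> card K" "constant_itinerary_on (mspace X) \<phi> \<U> K"
      using arb by blast
    have "2 / \<epsilon>\<^sup>2 \<le> card K"
      using order_trans[OF real_nat_ceiling_ge of_nat_mono[OF K(2)]] .
    then have card: "2 \<le> \<epsilon>\<^sup>2 * card K"
      using \<epsilon>(1) by (simp add: field_simps)
    have "\<forall>\<^sub>F n in sequentially. real (card ((set_inv\<^bsub>G\<^esub> K <#>\<^bsub>G\<^esub> F n) \<inter>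
        (set_inv\<^bsub>G\<^esub> K <#>\<^bsub>G\<^esub> (carrier G - F n)))) < 1 * real (card (F n))"
      using F K(1) zero_less_one unfolding folner_seq_def by blast
    then have "\<forall>\<^sub>F n in sequentially. norm (ln (real (?N n)) / real (card (F n)) - 0) < r"
    proof eventually_elim
      case (elim n)
      have le: "ln (?N n) \<le> 2 * \<epsilon> * card (F n) * ?q"
        using folner_ln_cover_number_le[OF act \<open>finite \<U>\<close> cover K(1,3) Ffin \<epsilon>(1) card elim] .
      have pos: "real (card (F n)) > 0"
        using Ffin[of n] unfolding fin_subsets_def by (auto simp: card_gt_0_iff)
      have "ln (?N n) / card (F n) \<le> 2 * \<epsilon> * ?q"
        using le pos by (simp add: field_simps)
      moreover have "ln (?N n) / card (F n) \<ge> 0"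
        by (cases "?N n") simp_all
      ultimately show ?case
        using \<epsilon>(2) by simp
    qed
    then show "\<exists>no. \<forall>n\<ge>no. norm (ln (real (?N n)) / real (card (F n)) - 0) < r"
      by (simp add: eventually_sequentially)
  qed
qed

section \<open>Visits in transitive systems without isolated points\<close>

lemma G_system_continuous_map:
  assumes "G_system G X \<phi>" and "g \<in> carrier G"
  shows "continuous_map (mtopology_of X) (mtopology_of X) (\<phi> g)"
proof -
  have "continuous_map (mtopology_of X) (prod_topology (discrete_topology (carrier G)) (mtopology_of X))
     (\<lambda>x. (g, x))"
    using assms(2) by (intro continuous_map_pairedI) auto
  from continuous_map_compose[OF this, of "mtopology_of X" "\<lambda>(g, x). \<phi> g x"] show ?thesis
    using assms(1) by (simp add: G_system_def o_def)
qed

lemma openin_pull_back: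
  assumes "G_system G X \<phi>" "g \<in> carrier G" "openin (mtopology_of X) U"
  shows "openin (mtopology_of X) (pull_back (mspace X) \<phi> g U)"
  using openin_continuous_map_preimage[OF G_system_continuous_map[OF assms(1,2)] assms(3)]
  by (simp add: pull_back_def)

lemma metrizable_space_mtopology_of: "metrizable_space (mtopology_of X)"
  unfolding mtopology_of_def by (rule Metric_space.metrizable_space_mtopology) simp

text \<open>A single time \<open>h\<close> is excluded by choosing \<open>x \<in> U\<close> and a point \<open>y \<in> V\<close> other than \<open>h x\<close>, which
  exists as no point is isolated, and separating \<open>h x\<close> from \<open>y\<close> by open sets. Finitely many times
  are excluded one after the other.\<close>

lemma shrink_avoiding_returns:
  assumes sys: "G_system G Y \<psi>" and iso: "no_isolated_points Y" and "finite H" "H \<subseteq> carrier G"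
    and U: "openin (mtopology_of Y) U" "U \<noteq> {}" and V: "openin (mtopology_of Y) V" "V \<noteq> {}"
  shows "\<exists>U' V'. openin (mtopology_of Y) U' \<and> U' \<noteq> {} \<and> U' \<subseteq> U \<and>
           openin (mtopology_of Y) V' \<and> V' \<noteq> {} \<and> V' \<subseteq> V \<and> return_set G Y \<psi> U' V' \<inter> H = {}"
  using assms(3,4)
proof (induction H)
  case empty
  then show ?case using U V by blast
next
  case (insert h H)
  interpret group_action G "mspace Y" \<psi> using sys unfolding G_system_def by blast
  have h: "h \<in> carrier G" using insert.prems by blast
  obtain U1 V1 where 1: "openin (mtopology_of Y) U1" "U1 \<noteq> {}" "U1 \<subseteq> U"
      "openin (mtopology_of Y) V1" "V1 \<noteq> {}" "V1 \<subseteq> V" "return_set G Y \<psi> U1 V1 \<inter> H = {}"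
    using insert by blast
  obtain x where x: "x \<in> U1" using 1 by blast
  have xY: "x \<in> mspace Y" using x openin_subset[OF 1(1)] by auto
  have hx: "\<psi> h x \<in> mspace Y" using element_image[OF h xY] by blast
  have "V1 \<noteq> {\<psi> h x}"
    using 1(4) hx iso unfolding no_isolated_points_def by blast
  then obtain y where y: "y \<in> V1" "y \<noteq> \<psi> h x"
    using 1(5) by blast
  have "y \<in> mspace Y" using y openin_subset[OF 1(4)] by auto
  moreover have "Hausdorff_space (mtopology_of Y)"
    by (simp add: metrizable_imp_Hausdorff_space metrizable_space_mtopology_of)
  ultimately obtain P Q where PQ: "openin (mtopology_of Y) P" "openin (mtopology_of Y) Q"
      "\<psi> h x \<in> P" "y \<in> Q" "disjnt P Q"
    using hx y(2) unfolding Hausdorff_space_def topspace_mtopology_of by metis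
  let ?U = "U1 \<inter> pull_back (mspace Y) \<psi> h P" and ?V = "V1 \<inter> Q"
  have "openin (mtopology_of Y) ?U" "openin (mtopology_of Y) ?V"
    using 1 PQ openin_pull_back[OF sys h] by (auto intro: openin_Int)
  moreover have "x \<in> ?U" "y \<in> ?V"
    using x xY y PQ by (auto simp: pull_back_def)
  moreover have "return_set G Y \<psi> ?U ?V \<subseteq> return_set G Y \<psi> U1 V1"
    unfolding return_set_def pull_back_def by blast
  moreover have "h \<notin> return_set G Y \<psi> ?U ?V"
    using PQ(5) by (auto simp: return_set_def pull_back_def disjnt_iff)
  ultimately have "openin (mtopology_of Y) ?U \<and> ?U \<noteq> {} \<and> ?U \<subseteq> U \<and>
           openin (mtopology_of Y) ?V \<and> ?V \<noteq> {} \<and> ?V \<subseteq> V \<and> return_set G Y \<psi> ?U ?V \<inter> insert h H = {}"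
    using 1(3,6,7) by blast
  then show ?case
    by (intro exI)
qed

text \<open>Transitivity, applied after \<open>U\<close> and \<open>V\<close> have been shrunk to exclude the times in \<open>H\<close>.\<close>

lemma return_set_not_subset_finite:
  assumes "G_system G Y \<psi>" "transitive_system G Y \<psi>" "no_isolated_points Y"
    and "finite H" "H \<subseteq> carrier G"
    and "openin (mtopology_of Y) U" "U \<noteq> {}" "openin (mtopology_of Y) V" "V \<noteq> {}"
  shows "\<exists>g \<in> return_set G Y \<psi> U V. g \<notin> H"
proof -
  obtain U' V' where 1: "openin (mtopology_of Y) U'" "U' \<noteq> {}" "U' \<subseteq> U"
      "openin (mtopology_of Y) V'" "V' \<noteq> {}" "V' \<subseteq> V" "return_set G Y \<psi> U' V' \<inter> H = {}"
    using shrink_avoiding_returns[OF assms(1,3-)] by blast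
  then have "return_set G Y \<psi> U' V' \<noteq> {}"
    using assms(2) unfolding transitive_system_def by blast
  moreover have "return_set G Y \<psi> U' V' \<subseteq> return_set G Y \<psi> U V"
    using 1(3,6) unfolding return_set_def pull_back_def by blast
  ultimately show ?thesis
    using 1(7) by blast
qed

text \<open>If \<open>W\<close> is a non-empty open set that every \<open>g \<in> K\<close> sends into \<open>V\<close>, then a return time \<open>g \<notin> K\<close>
  from \<open>W\<close> to \<open>V\<close> enlarges \<open>K\<close>, with \<open>W\<close> replaced by the open set \<open>W \<inter> g\<^sup>-\<^sup>1 V\<close>.\<close>

lemma many_simultaneous_visits:
  assumes sys: "G_system G Y \<psi>" "transitive_system G Y \<psi>" "no_isolated_points Y"
    and V: "openin (mtopology_of Y) V" "V \<noteq> {}"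
  shows "\<exists>K \<subseteq> carrier G. finite K \<and> card K = m \<and> (\<exists>y\<in>mspace Y. \<forall>g\<in>K. \<psi> g y \<in> V)"
proof -
  have "\<exists>K W. K \<subseteq> carrier G \<and> finite K \<and> card K = m \<and> openin (mtopology_of Y) W \<and> W \<noteq> {} \<and>
         (\<forall>g\<in>K. \<forall>y\<in>W. \<psi> g y \<in> V)"
  proof (induction m)
    case 0
    then show ?case using V by (intro exI[of _ "{}"] exI[of _ V]) simp
  next
    case (Suc m)
    then obtain K W where KW: "K \<subseteq> carrier G" "finite K" "card K = m" "openin (mtopology_of Y) W"
        "W \<noteq> {}" "\<forall>g\<in>K. \<forall>y\<in>W. \<psi> g y \<in> V"
      by blast
    obtain g where g: "g \<in> return_set G Y \<psi> W V" "g \<notin> K"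
      using return_set_not_subset_finite[OF sys KW(2,1,4,5) V] by blast
    have gG: "g \<in> carrier G" using g unfolding return_set_def by blast
    let ?W = "W \<inter> pull_back (mspace Y) \<psi> g V"
    have "openin (mtopology_of Y) ?W"
      using KW openin_pull_back[OF sys(1) gG V(1)] by blast
    moreover have "?W \<noteq> {}"
      using g unfolding return_set_def by blast
    moreover have "\<forall>k\<in>insert g K. \<forall>y\<in>?W. \<psi> k y \<in> V"
      using KW(6) by (auto simp: pull_back_def)
    ultimately show ?case
      using KW gG g by (intro exI[of _ "insert g K"] exI[of _ ?W]) simp
  qed
  then obtain K W where KW: "K \<subseteq> carrier G" "finite K" "card K = m" "openin (mtopology_of Y) W"
        "W \<noteq> {}" "\<forall>g\<in>K. \<forall>y\<in>W. \<psi> g y \<in> V"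
    by blast
  then obtain y where "y \<in> W" by blast
  then have "y \<in> mspace Y" using openin_subset[OF KW(4)] by auto
  then show ?thesis
    using KW \<open>y \<in> W\<close> by blast
qed

section \<open>Positive entropy forces common return times\<close>

text \<open>If \<open>g x \<in> A\<close> and \<open>h x \<in> B\<close> for some \<open>g, h \<in> K\<close>, then \<open>h g\<^sup>-\<^sup>1\<close> moves \<open>g x\<close> from \<open>A\<close> to \<open>B\<close> and
  moves \<open>g y\<close> from \<open>V\<close> to \<open>V\<close>, which the last hypothesis rules out.\<close>

lemma constant_itinerary_on_complements:
  fixes G (structure)
  assumes act: "group_action G S \<phi>" and act': "group_action G T \<psi>" and K: "K \<subseteq> carrier G"
    and y: "y \<in> T" "\<And>g. g \<in> K \<Longrightarrow> \<psi> g y \<in> V"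
    and no: "\<And>g x z. \<lbrakk>g \<in> carrier G; x \<in> A; z \<in> V; z \<in> T; \<psi> g z \<in> V; x \<in> S\<rbrakk> \<Longrightarrow> \<phi> g x \<notin> B"
  shows "constant_itinerary_on S \<phi> {S - A, S - B} K"
  unfolding constant_itinerary_on_def
proof
  interpret X: group_action G S \<phi> by (fact act)
  interpret Y: group_action G T \<psi> by (fact act')
  interpret group G using X.group_hom group_hom.axioms(1) by blast
  fix x assume x: "x \<in> S"
  have S: "\<phi> g x \<in> S" if "g \<in> K" for g
    using X.element_image[of g x] x K that by blast
  have False if g: "g \<in> K" "\<phi> g x \<in> A" and h: "h \<in> K" "\<phi> h x \<in> B" for g h
  proof -
    have G: "g \<in> carrier G" "h \<in> carrier G" using g h K by auto
    let ?k = "h \<otimes> inv g"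
    have k: "?k \<in> carrier G" "?k \<otimes> g = h" using G by (simp_all add: m_assoc)
    have "\<phi> ?k (\<phi> g x) = \<phi> h x"
      using X.composition_rule[OF x k(1) G(1)] k(2) by simp
    moreover have "\<psi> ?k (\<psi> g y) = \<psi> h y"
      using Y.composition_rule[OF y(1) k(1) G(1)] k(2) by simp
    moreover have "\<psi> g y \<in> T"
      using Y.element_image[OF G(1) y(1)] by blast
    ultimately show False
      using no[of ?k "\<phi> g x" "\<psi> g y"] k(1) g h y(2) S by auto
  qed
  then have "(\<forall>g\<in>K. \<phi> g x \<notin> A) \<or> (\<forall>g\<in>K. \<phi> g x \<notin> B)"
    by meson
  then show "\<exists>U\<in>{S - A, S - B}. \<forall>g\<in>K. \<phi> g x \<in> U"
    using S by simp
qed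

lemma upe_disjoint_closed_sets:
  assumes upe: "upe G X \<phi>"
    and A: "closedin (mtopology_of X) A" "openin (mtopology_of X) A'" "A' \<noteq> {}" "A' \<subseteq> A"
    and B: "closedin (mtopology_of X) B" "openin (mtopology_of X) B'" "B' \<noteq> {}" "B' \<subseteq> B"
    and "A \<inter> B = {}"
  shows "h_top G X \<phi> {mspace X - A, mspace X - B} > 0"
proof -
  have nondense: "(mtopology_of X) closure_of (mspace X - C) \<noteq> mspace X"
    if C: "openin (mtopology_of X) C'" "C' \<noteq> {}" "C' \<subseteq> C" for C C'
  proof -
    obtain x where x: "x \<in> C'" using C by blast
    then have "x \<notin> (mtopology_of X) closure_of (mspace X - C)"
      using C by (auto simp: in_closure_of)
    then show ?thesis
      using x openin_subset[OF C(1)] by auto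
  qed
  have "openin (mtopology_of X) (mspace X - A)" "openin (mtopology_of X) (mspace X - B)"
    using openin_diff[OF openin_topspace A(1)] openin_diff[OF openin_topspace B(1)] by simp_all
  moreover have "(mspace X - A) \<union> (mspace X - B) = mspace X"
    using \<open>A \<inter> B = {}\<close> by blast
  ultimately show ?thesis
    using upe nondense[OF A(2-4)] nondense[OF B(2-4)] unfolding upe_def by blast
qed

lemma closed_inside_open:
  assumes "openin (mtopology_of X) U" "U \<noteq> {}"
  shows "\<exists>A A'. closedin (mtopology_of X) A \<and> openin (mtopology_of X) A' \<and> A' \<noteq> {} \<and> A' \<subseteq> A \<and> A \<subseteq> U"
proof -
  obtain x where "x \<in> U" using assms by blast
  moreover have "neighbourhood_base_of (closedin (mtopology_of X)) (mtopology_of X)"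
    by (simp add: metrizable_imp_regular_space metrizable_space_mtopology_of neighbourhood_base_of_closedin)
  ultimately show ?thesis
    using assms(1) unfolding neighbourhood_base_of by (metis empty_iff)
qed

text \<open>Contraposition: disjoint return sets would yield a cover to which both
  \<open>upe_disjoint_closed_sets\<close> and \<open>h_top_eq_0\<close> apply.\<close>

lemma upe_common_return:
  fixes G (structure)
  assumes am: "amenable G" and X: "G_system G X \<phi>" and upe: "upe G X \<phi>"
    and Y: "G_system G Y \<psi>" "transitive_system G Y \<psi>" "no_isolated_points Y"
    and U: "openin (mtopology_of X) U1" "U1 \<noteq> {}" "openin (mtopology_of X) U2" "U2 \<noteq> {}"
    and V: "openin (mtopology_of Y) V1" "V1 \<noteq> {}" "openin (mtopology_of Y) V2" "V2 \<noteq> {}"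
  shows "return_set G X \<phi> U1 U2 \<inter> return_set G Y \<psi> V1 V2 \<noteq> {}"
proof
  assume no: "return_set G X \<phi> U1 U2 \<inter> return_set G Y \<psi> V1 V2 = {}"
  interpret X: group_action G "mspace X" \<phi> using X unfolding G_system_def by blast
  interpret Y: group_action G "mspace Y" \<psi> using Y unfolding G_system_def by blast
  interpret group G using X.group_hom group_hom.axioms(1) by blast
  obtain h where h: "h \<in> return_set G Y \<psi> V1 V2"
    using Y(2) V unfolding transitive_system_def by blast
  then have hG: "h \<in> carrier G" unfolding return_set_def by blast
  let ?V = "V1 \<inter> pull_back (mspace Y) \<psi> h V2" and ?W = "pull_back (mspace X) \<phi> h U2"
  have V': "openin (mtopology_of Y) ?V" "?V \<noteq> {}"
    using h V openin_pull_back[OF Y(1) hG] unfolding return_set_def by auto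
  have W: "openin (mtopology_of X) ?W"
    using openin_pull_back[OF X hG U(3)] .
  have "?W \<noteq> {}"
  proof -
    obtain u where "u \<in> U2" using U by blast
    moreover have "u \<in> \<phi> h ` mspace X"
      using X.surj_prop[OF hG] openin_subset[OF U(3)] \<open>u \<in> U2\<close> by auto
    ultimately show ?thesis by (auto simp: pull_back_def)
  qed
  obtain A A' where A: "closedin (mtopology_of X) A" "openin (mtopology_of X) A'" "A' \<noteq> {}" "A' \<subseteq> A"
      "A \<subseteq> U1"
    using closed_inside_open[OF U(1,2)] by blast
  obtain B B' where B: "closedin (mtopology_of X) B" "openin (mtopology_of X) B'" "B' \<noteq> {}" "B' \<subseteq> B"
      "B \<subseteq> ?W"
    using closed_inside_open[OF W \<open>?W \<noteq> {}\<close>] by blast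
  have "h \<notin> return_set G X \<phi> U1 U2"
    using no h by blast
  \<comment> \<open>A common point of \<open>A\<close> and \<open>B\<close> would be sent from \<open>U1\<close> to \<open>U2\<close> by \<open>h\<close>.\<close>
  then have "A \<inter> B = {}"
    using A(5) B(5) hG unfolding return_set_def by blast
  have clash: "\<phi> g x \<notin> B"
    if "g \<in> carrier G" "x \<in> A" "z \<in> ?V" "z \<in> mspace Y" "\<psi> g z \<in> ?V" "x \<in> mspace X" for g x z
  proof
    assume "\<phi> g x \<in> B"
    then have "\<phi> (h \<otimes> g) x \<in> U2"
      using B(5) X.composition_rule[OF that(6) hG that(1)] by (auto simp: pull_back_def)
    then have "h \<otimes> g \<in> return_set G X \<phi> U1 U2"
      using that A(5) hG by (auto simp: return_set_def pull_back_def)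
    moreover have "\<psi> (h \<otimes> g) z \<in> V2"
      using that(5) Y.composition_rule[OF that(4) hG that(1)] by (auto simp: pull_back_def)
    then have "h \<otimes> g \<in> return_set G Y \<psi> V1 V2"
      using that hG by (auto simp: return_set_def pull_back_def)
    ultimately show False
      using no by blast
  qed
  have "h_top G X \<phi> {mspace X - A, mspace X - B} = 0"
  proof (rule h_top_eq_0[OF am X.group_action_axioms])
    fix m :: nat
    obtain K y where K: "K \<subseteq> carrier G" "finite K" "card K = Suc m" "y \<in> mspace Y"
        "\<forall>g\<in>K. \<psi> g y \<in> ?V"
      using many_simultaneous_visits[OF Y V', of "Suc m"] by blast
    have "constant_itinerary_on (mspace X) \<phi> {mspace X - A, mspace X - B} K"
    proof (rule constant_itinerary_on_complements[OF X.group_action_axioms Y.group_action_axioms K(1,4)])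
      show "\<psi> g y \<in> ?V" if "g \<in> K" for g
        using K(5) that by (rule bspec)
    qed (rule clash)
    moreover have "K \<in> fin_subsets G"
      using K unfolding fin_subsets_def by auto
    ultimately show "\<exists>K\<in>fin_subsets G. m \<le> card K \<and>
        constant_itinerary_on (mspace X) \<phi> {mspace X - A, mspace X - B} K"
      using K(3) by (intro bexI[of _ K] conjI) simp_all
  qed (use \<open>A \<inter> B = {}\<close> in auto)
  then show False
    using upe_disjoint_closed_sets[OF upe A(1-4) B(1-4) \<open>A \<inter> B = {}\<close>] by simp
qed

lemma upe_mildly_mixing:
  fixes X :: "'x metric"
  assumes "amenable G" "G_system G X \<phi>" "upe G X \<phi>"
  shows "mildly_mixing TYPE('y) G X \<phi>"
  unfolding mildly_mixing_def
proof clarify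
  fix Y :: "'y metric" and \<psi>
  assume Y: "G_system G Y \<psi>" "transitive_system G Y \<psi>" "no_isolated_points Y"
  have rect: "\<exists>U V. openin (mtopology_of X) U \<and> openin (mtopology_of Y) V \<and> U \<noteq> {} \<and> V \<noteq> {} \<and> U \<times> V \<subseteq> P"
    if P: "openin (mtopology_of (prod_metric X Y)) P" "P \<noteq> {}" for P
  proof -
    obtain x y where xy: "(x, y) \<in> P" using P by auto
    have "openin (prod_topology (mtopology_of X) (mtopology_of Y)) P"
      using P(1) by simp
    then obtain U V where "openin (mtopology_of X) U" "openin (mtopology_of Y) V" "x \<in> U" "y \<in> V" "U \<times> V \<subseteq> P"
      unfolding openin_prod_topology_alt using xy by meson
    then show ?thesis
      by (intro exI[of _ U] exI[of _ V]) auto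
  qed
  show "transitive_system G (prod_metric X Y) (diag_action X \<phi> Y \<psi>)"
    unfolding transitive_system_def
  proof clarify
    fix P Q assume P: "openin (mtopology_of (prod_metric X Y)) P" "P \<noteq> {}"
      and Q: "openin (mtopology_of (prod_metric X Y)) Q" "Q \<noteq> {}"
      and empty: "return_set G (prod_metric X Y) (diag_action X \<phi> Y \<psi>) P Q = {}"
    obtain U1 V1 where 1: "openin (mtopology_of X) U1" "openin (mtopology_of Y) V1" "U1 \<noteq> {}" "V1 \<noteq> {}"
        "U1 \<times> V1 \<subseteq> P"
      using rect[OF P] by blast
    obtain U2 V2 where 2: "openin (mtopology_of X) U2" "openin (mtopology_of Y) V2" "U2 \<noteq> {}" "V2 \<noteq> {}"
        "U2 \<times> V2 \<subseteq> Q"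
      using rect[OF Q] by blast
    obtain g where "g \<in> return_set G X \<phi> U1 U2" "g \<in> return_set G Y \<psi> V1 V2"
      using upe_common_return[OF assms Y 1(1,3) 2(1,3) 1(2,4) 2(2,4)] by blast
    then obtain x y where "g \<in> carrier G" "x \<in> U1" "x \<in> mspace X" "\<phi> g x \<in> U2"
        "y \<in> V1" "y \<in> mspace Y" "\<psi> g y \<in> V2"
      unfolding return_set_def pull_back_def by blast
    then have "(x, y) \<in> P \<inter> pull_back (mspace (prod_metric X Y)) (diag_action X \<phi> Y \<psi>) g Q"
      using subsetD[OF 1(5), of "(x, y)"] subsetD[OF 2(5), of "(\<phi> g x, \<psi> g y)"]
      by (simp add: pull_back_def diag_action_def)
    then have "g \<in> return_set G (prod_metric X Y) (diag_action X \<phi> Y \<psi>) P Q"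
      using \<open>g \<in> carrier G\<close> unfolding return_set_def by blast
    then show False
      using empty by simp
  qed
qed

theorem theorem7p10:
  fixes G :: "('g, 'm) monoid_scheme"
    and X :: "'x metric"
    and \<phi> :: "'g \<Rightarrow> 'x \<Rightarrow> 'x"
  assumes "group G"
    and "countable (carrier G)"
    and "infinite (carrier G)"
    and "amenable G"
    and "G_system G X \<phi>"
    and "upe G X \<phi>"
  shows "mildly_mixing TYPE('y) G X \<phi>"
  using upe_mildly_mixing[OF assms(4-6)] .

end
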